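(* Let $p>2$ be a prime, $M=M[A]$ a simple, coloopless $p$-matroid on ground set $E$, $a,b\in E$ distinct, $\alpha\in GF(p)$ nonzero, and $e=b$. Then the $es$-splitting matroid $M^e_{a,b}$ is Eulerian if and only if there exists a collection of circuits $\{C_{np},C_1,\dots,C_k\}$ of $M$, where $C_{np}$ is an $np$-circuit containing $a$ and $b$, such that $E=C_{np}\cup C_1\cup\dots\cup C_k$ and the circuits in the collection are pairwise disjoint except that $C_{np}\cap C_1=\{b\}$.
   Context: A $p$-matroid is a matroid representable over $GF(p)$, $A$ a representing matrix over $GF(p)$ with columns indexed by $E$. $A'_{a,b}$ is obtained from $A$ by appending a last row with $\alpha$ in columns $a,b$ and $0$ elsewhere, then a column $z$ with last coordinate $\alpha$ and $0$ elsewhere. $A^e_{a,b}$ is obtained from $A'_{a,b}$ by appending a column $\gamma$ = (column of $e$) $-$ (column $z$); $M^e_{a,b}$ is the vector matroid of $A^e_{a,b}$ on $E\cup\{z,\gamma\}$. For a circuit $C$ of $M$ let $c_u$ ($u\in C$) be nonzero scalars, unique up to common factor, with $\sum c_uu=0$; $C$ is an $np$-circuit if $|C\cap\{a,b\}|=1$, or $\{a,b\}\subseteq C$ and $c_a+c_b\neq 0$. A matroid is Eulerian if its ground set is a disjoint union of circuits. *)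

theory Defs
  imports "HOL-Analysis.Analysis"
begin

record 'e indep_system =
  ground :: "'e set"
  indep :: "'e set \<Rightarrow> bool"

definition circuit :: "'e indep_system \<Rightarrow> 'e set \<Rightarrow> bool" where
  "circuit M C \<longleftrightarrow> C \<subseteq> ground M \<and> \<not> indep M C \<and> (\<forall>D. D \<subset> C \<longrightarrow> indep M D)"

definition basis :: "'e indep_system \<Rightarrow> 'e set \<Rightarrow> bool" where
  "basis M B \<longleftrightarrow> B \<subseteq> ground M \<and> indep M B \<and>
     (\<forall>X. B \<subset> X \<and> X \<subseteq> ground M \<longrightarrow> \<not> indep M X)"

definition loop :: "'e indep_system \<Rightarrow> 'e \<Rightarrow> bool" where
  "loop M x \<longleftrightarrow> circuit M {x}"

definition parallel :: "'e indep_system \<Rightarrow> 'e \<Rightarrow> 'e \<Rightarrow> bool" where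
  "parallel M x y \<longleftrightarrow> x \<noteq> y \<and> circuit M {x, y}"

definition simple_matroid :: "'e indep_system \<Rightarrow> bool" where
  "simple_matroid M \<longleftrightarrow> (\<nexists>x. loop M x) \<and> (\<nexists>x y. parallel M x y)"

definition coloop :: "'e indep_system \<Rightarrow> 'e \<Rightarrow> bool" where
  "coloop M x \<longleftrightarrow> x \<in> ground M \<and> (\<forall>B. basis M B \<longrightarrow> x \<in> B)"

definition coloopless :: "'e indep_system \<Rightarrow> bool" where
  "coloopless M \<longleftrightarrow> (\<nexists>x. coloop M x)"

definition eulerian :: "'e indep_system \<Rightarrow> bool" where
  "eulerian M \<longleftrightarrow> (\<exists>\<C>. (\<forall>C\<in>\<C>. circuit M C) \<and> disjoint \<C> \<and> \<Union>\<C> = ground M)"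

text \<open>A matrix with rows indexed by \<^typ>\<open>'m\<close> and columns indexed by \<open>E\<close> is given by its
  columns \<open>A u\<close>, \<open>u \<in> E\<close>. Two labels may carry the same column, so the injectivity condition
  makes independence refer to the family of columns rather than to the set of columns.\<close>

definition vector_matroid :: "'e set \<Rightarrow> ('e \<Rightarrow> 'k::field ^ 'm) \<Rightarrow> 'e indep_system" where
  "vector_matroid E A =
     \<lparr>ground = E, indep = (\<lambda>X. X \<subseteq> E \<and> inj_on A X \<and> vec.independent (A ` X))\<rparr>"

text \<open>\<open>A'\<^sub>a\<^sub>,\<^sub>b\<close>: the row index \<^const>\<open>None\<close> is the appended last row.\<close>

definition split_matrix ::
  "('e \<Rightarrow> 'k::field ^ 'm) \<Rightarrow> 'e \<Rightarrow> 'e \<Rightarrow> 'k \<Rightarrow> 'e \<Rightarrow> ('e \<Rightarrow> 'k ^ 'm option)" where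
  "split_matrix A a b \<alpha> z u =
     (\<chi> i. case i of
         Some j \<Rightarrow> (if u = z then 0 else A u $ j)
       | None \<Rightarrow> (if u = z \<or> u = a \<or> u = b then \<alpha> else 0))"

definition es_matrix ::
  "('e \<Rightarrow> 'k::field ^ 'm) \<Rightarrow> 'e \<Rightarrow> 'e \<Rightarrow> 'k \<Rightarrow> 'e \<Rightarrow> 'e \<Rightarrow> 'e \<Rightarrow> ('e \<Rightarrow> 'k ^ 'm option)" where
  "es_matrix A a b \<alpha> e z \<gamma> u =
     (if u = \<gamma> then split_matrix A a b \<alpha> z e - split_matrix A a b \<alpha> z z
      else split_matrix A a b \<alpha> z u)"

definition es_splitting ::
  "'e set \<Rightarrow> ('e \<Rightarrow> 'k::field ^ 'm) \<Rightarrow> 'e \<Rightarrow> 'e \<Rightarrow> 'k \<Rightarrow> 'e \<Rightarrow> 'e \<Rightarrow> 'e \<Rightarrow> 'e indep_system" where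
  "es_splitting E A a b \<alpha> e z \<gamma> = vector_matroid (E \<union> {z, \<gamma>}) (es_matrix A a b \<alpha> e z \<gamma>)"

definition circuit_coeffs :: "('e \<Rightarrow> 'k::field ^ 'm) \<Rightarrow> 'e set \<Rightarrow> ('e \<Rightarrow> 'k) \<Rightarrow> bool" where
  "circuit_coeffs A C c \<longleftrightarrow> (\<forall>u\<in>C. c u \<noteq> 0) \<and> (\<Sum>u\<in>C. c u *s A u) = 0"

text \<open>The coefficients of a circuit are unique up to a common nonzero factor, so it does not matter
  that they are quantified existentially here.\<close>

definition np_circuit :: "'e set \<Rightarrow> ('e \<Rightarrow> 'k::field ^ 'm) \<Rightarrow> 'e \<Rightarrow> 'e \<Rightarrow> 'e set \<Rightarrow> bool" where
  "np_circuit E A a b C \<longleftrightarrow> circuit (vector_matroid E A) C \<and>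
     (card (C \<inter> {a, b}) = 1 \<or>
      {a, b} \<subseteq> C \<and> (\<exists>c. circuit_coeffs A C c \<and> c a + c b \<noteq> 0))"

end

theory Submission
  imports Defs
begin

text \<open>Up to the factor \<open>\<alpha>\<close> in the last row, a linear relation \<open>c\<close> between the columns of
  \<open>A\<^sup>e\<^sub>a\<^sub>,\<^sub>b\<close> with \<open>e = b\<close> is a relation between the columns of \<open>A\<close>, where \<open>\<gamma>\<close> stands for a second
  copy of \<open>b\<close> and \<open>z\<close> for a zero column, that satisfies the balance condition
  \<open>c a + c b + c z = 0\<close>. So no circuit meets \<open>{a, b, z}\<close> in exactly one element, and in a partition
  into circuits \<open>a\<close>, \<open>b\<close>, \<open>z\<close> lie in one circuit \<open>D\<close>. It does not contain \<open>\<gamma>\<close>, because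
  \<open>{b, z, \<gamma>}\<close> is dependent and misses \<open>a\<close>. Then \<open>D - {z}\<close> is the np-circuit, and replacing \<open>\<gamma>\<close> by
  \<open>b\<close> in the circuit through \<open>\<gamma>\<close> gives \<open>C\<^sub>1\<close>. The other circuits avoid \<open>a\<close>, \<open>b\<close>, \<open>z\<close>, \<open>\<gamma>\<close> and
  are circuits of both matroids. All these steps are reversible.\<close>

section \<open>Linear relations between labelled columns, and circuits described by them\<close>

definition column_relation :: "('e \<Rightarrow> 'k::field ^ 'm) \<Rightarrow> 'e set \<Rightarrow> ('e \<Rightarrow> 'k) \<Rightarrow> bool" where
  "column_relation A X c \<longleftrightarrow> (\<Sum>u\<in>X. c u *s A u) = 0"

lemma column_relation_cong:
  assumes "\<And>u. u \<in> X \<Longrightarrow> c u = d u" and "\<And>u. u \<in> X \<Longrightarrow> A u = B u"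
  shows "column_relation A X c \<longleftrightarrow> column_relation B X d"
  unfolding column_relation_def using assms by (metis (mono_tags, lifting) sum.cong)

lemma column_relation_mono_neutral:
  assumes "finite Y" "X \<subseteq> Y" "\<And>u. u \<in> Y - X \<Longrightarrow> c u = 0"
  shows "column_relation A Y c \<longleftrightarrow> column_relation A X c"
proof -
  have "(\<Sum>u\<in>X. c u *s A u) = (\<Sum>u\<in>Y. c u *s A u)"
    by (rule sum.mono_neutral_left) (use assms in auto)
  then show ?thesis
    by (simp add: column_relation_def)
qed

text \<open>Two labels \<open>u\<close>, \<open>v\<close> with the same column give the relation
  with coefficients 1 and -1. Once \<open>A\<close> is injective on \<open>X\<close>, reindexing
  along \<open>A\<close> identifies relations on labels with relations on vectors.\<close>

lemma indep_vector_matroid_iff: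
  fixes A :: "'e \<Rightarrow> 'k::field ^ 'm"
  assumes fin: "finite X"
  shows "indep (vector_matroid E A) X \<longleftrightarrow>
    X \<subseteq> E \<and> (\<forall>c. column_relation A X c \<longrightarrow> (\<forall>u\<in>X. c u = 0))"
proof -
  have "inj_on A X \<and> vec.independent (A ` X) \<longleftrightarrow>
    (\<forall>c. column_relation A X c \<longrightarrow> (\<forall>u\<in>X. c u = 0))" (is "?L \<longleftrightarrow> ?R")
  proof
    assume L: ?L
    show ?R
    proof (intro allI impI ballI)
      fix c u assume c: "column_relation A X c" and u: "u \<in> X"
      \<comment> \<open>Coefficients move from labels to vectors, which is unambiguous because
        \<open>A\<close> is injective on \<open>X\<close>.\<close>
      define f where "f = (\<lambda>v. c (inv_into X A v))"
      have "(\<Sum>v\<in>A ` X. f v *s v) = (\<Sum>u\<in>X. c u *s A u)"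
        using L by (simp add: sum.reindex f_def)
      also have "\<dots> = 0"
        using c by (simp add: column_relation_def)
      finally have "f (A u) = 0"
        using L u fin by (auto simp: vec.dependent_finite)
      then show "c u = 0"
        using L u by (simp add: f_def)
    qed
  next
    assume R: ?R
    have inj: "inj_on A X"
    proof (rule inj_onI, rule ccontr)
      fix u v assume uv: "u \<in> X" "v \<in> X" "A u = A v" "u \<noteq> v"
      define c where "c = (\<lambda>w. if w = u then 1 else if w = v then -1 else 0 :: 'k)"
      have "column_relation A X c \<longleftrightarrow> column_relation A {u, v} c"
        by (rule column_relation_mono_neutral) (use uv fin in \<open>auto simp: c_def\<close>)
      moreover have "column_relation A {u, v} c"
        using uv by (simp add: column_relation_def c_def)
      ultimately have "c u = 0"
        using R uv by blast
      then show False
        by (simp add: c_def)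
    qed
    have "vec.independent (A ` X)"
    proof
      assume "vec.dependent (A ` X)"
      then obtain f x where f: "x \<in> X" "f (A x) \<noteq> 0" "(\<Sum>v\<in>A ` X. f v *s v) = 0"
        using fin by (auto simp: vec.dependent_finite)
      then have "column_relation A X (\<lambda>u. f (A u))"
        using inj by (simp add: column_relation_def sum.reindex)
      then show False
        using R f by blast
    qed
    with inj show ?L ..
  qed
  then show ?thesis
    by (simp add: vector_matroid_def)
qed

text \<open>A relation that vanishes somewhere on \<open>C\<close> is a relation on a proper subset,
  so minimality says that it is trivial. In this form proper subsets disappear, and circuits of two
  matroids can be compared by matching relations alone.\<close>

lemma circuit_vector_matroid_iff:
  fixes A :: "'e \<Rightarrow> 'k::field ^ 'm"
  assumes "finite E"
  shows "circuit (vector_matroid E A) C \<longleftrightarrow>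
    C \<subseteq> E \<and> (\<exists>c. column_relation A C c \<and> (\<exists>u\<in>C. c u \<noteq> 0)) \<and>
    (\<forall>c. column_relation A C c \<longrightarrow> (\<exists>u\<in>C. c u = 0) \<longrightarrow> (\<forall>u\<in>C. c u = 0))"
    (is "?L \<longleftrightarrow> ?R")
proof
  assume L: ?L
  have CE: "C \<subseteq> E"
    using L by (simp add: circuit_def vector_matroid_def)
  then have fin: "finite C"
    using assms finite_subset by blast
  have "c u = 0" if c: "column_relation A C c" and v: "v \<in> C" "c v = 0" and u: "u \<in> C" for c u v
  proof (cases "u = v")
    case False
    have "column_relation A (C - {v}) c"
      using column_relation_mono_neutral[of C "C - {v}" c A] fin c v by auto
    moreover have "indep (vector_matroid E A) (C - {v})"
      using L v by (auto simp: circuit_def)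
    ultimately show ?thesis
      using fin u False by (simp add: indep_vector_matroid_iff)
  qed (use v in simp)
  moreover have "\<exists>c. column_relation A C c \<and> (\<exists>u\<in>C. c u \<noteq> 0)"
    using L fin CE by (auto simp: circuit_def indep_vector_matroid_iff)
  ultimately show ?R
    using CE by blast
next
  assume R: ?R
  have fin: "finite C"
    using assms R finite_subset by blast
  have "indep (vector_matroid E A) D" if D: "D \<subset> C" for D
  proof -
    have "c u = 0" if c: "column_relation A D c" and u: "u \<in> D" for c u
    proof -
      \<comment> \<open>Extension by zero; since \<open>D\<close> is a proper subset,
        \<open>d\<close> has a zero on \<open>C\<close>.\<close>
      define d where "d = (\<lambda>w. if w \<in> D then c w else 0)"
      have "column_relation A C d \<longleftrightarrow> column_relation A D d"
        by (rule column_relation_mono_neutral) (use D fin in \<open>auto simp: d_def\<close>)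
      also have "\<dots> \<longleftrightarrow> column_relation A D c"
        by (rule column_relation_cong) (simp_all add: d_def)
      finally have "column_relation A C d"
        using c by simp
      moreover have "\<exists>w\<in>C. d w = 0"
        using D by (auto simp: d_def)
      ultimately have "d u = 0"
        using R D u by blast
      then show ?thesis
        using u by (simp add: d_def)
    qed
    moreover have "finite D" "D \<subseteq> E"
      using D fin R finite_subset by blast+
    ultimately show ?thesis
      by (simp add: indep_vector_matroid_iff)
  qed
  moreover have "\<not> indep (vector_matroid E A) C"
    using R fin by (auto simp: indep_vector_matroid_iff)
  ultimately show ?L
    using R by (simp add: circuit_def vector_matroid_def)
qed

lemma circuit_vector_matroid_nonzero_relation:
  assumes "finite E" "circuit (vector_matroid E A) C"
  obtains c where "column_relation A C c" "\<And>u. u \<in> C \<Longrightarrow> c u \<noteq> 0"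
  using assms by (auto simp: circuit_vector_matroid_iff)

section \<open>Relations between the columns of the es-splitting matrix\<close>

locale es_splitting_setup =
  fixes E :: "'e set" and A :: "'e \<Rightarrow> 'k::field ^ 'm" and a b z \<gamma> :: 'e and \<alpha> :: 'k
  assumes finite_E: "finite E" and a_in_E: "a \<in> E" and b_in_E: "b \<in> E" and a_neq_b: "a \<noteq> b"
    and alpha_nonzero: "\<alpha> \<noteq> 0"
    and z_notin_E: "z \<notin> E" and gamma_notin_E: "\<gamma> \<notin> E" and z_neq_gamma: "z \<noteq> \<gamma>"
begin

abbreviation M where "M \<equiv> vector_matroid E A"
abbreviation B where "B \<equiv> es_matrix A a b \<alpha> b z \<gamma>"
abbreviation N where "N \<equiv> es_splitting E A a b \<alpha> b z \<gamma>"

lemma distinct_elements [simp]: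
  "a \<noteq> b" "b \<noteq> a" "a \<noteq> z" "z \<noteq> a" "b \<noteq> z" "z \<noteq> b"
  "a \<noteq> \<gamma>" "\<gamma> \<noteq> a" "b \<noteq> \<gamma>" "\<gamma> \<noteq> b" "z \<noteq> \<gamma>" "\<gamma> \<noteq> z"
  using a_in_E b_in_E a_neq_b z_notin_E gamma_notin_E z_neq_gamma by auto

lemma es_matrix_nth_Some: "B u $ Some j = (A(\<gamma> := A b, z := 0)) u $ j"
  by (simp add: es_matrix_def split_matrix_def)

lemma es_matrix_nth_None: "B u $ None = (if u \<in> {a, b, z} then \<alpha> else 0)"
  by (simp add: es_matrix_def split_matrix_def)

text \<open>The old rows see \<gamma> as a copy of \<open>b\<close> and \<open>z\<close> as zero. In
  the new row \<gamma> has entry \<alpha> - \<alpha> = 0, so only \<open>a\<close>,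
  \<open>b\<close>, \<open>z\<close> contribute, each with the factor \<alpha>, which
  cancels.\<close>

lemma column_relation_es_matrix_iff:
  assumes "finite X"
  shows "column_relation B X c \<longleftrightarrow>
    column_relation (A(\<gamma> := A b, z := 0)) X c \<and> sum c (X \<inter> {a, b, z}) = 0"
proof -
  have "(\<Sum>u\<in>X. c u * B u $ None) = (\<Sum>u\<in>X. if u \<in> {a, b, z} then c u * \<alpha> else 0)"
    by (rule sum.cong) (simp_all add: es_matrix_nth_None)
  also have "\<dots> = sum c (X \<inter> {a, b, z}) * \<alpha>"
    by (subst sum.inter_restrict[OF assms, symmetric]) (simp add: sum_distrib_right)
  finally have "(\<Sum>u\<in>X. c u * B u $ None) = 0 \<longleftrightarrow> sum c (X \<inter> {a, b, z}) = 0"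
    using alpha_nonzero by simp
  moreover have "column_relation B X c \<longleftrightarrow>
    (\<forall>j. (\<Sum>u\<in>X. c u * B u $ Some j) = 0) \<and> (\<Sum>u\<in>X. c u * B u $ None) = 0"
    by (auto simp: column_relation_def vec_eq_iff split_option_all)
  ultimately show ?thesis
    by (simp add: column_relation_def vec_eq_iff es_matrix_nth_Some)
qed

lemma column_relation_es_matrix_avoiding:
  assumes "X \<subseteq> E - {a, b}"
  shows "column_relation B X c \<longleftrightarrow> column_relation A X c"
proof -
  have "finite X"
    using assms finite_E finite_subset by blast
  moreover have "X \<inter> {a, b, z} = {}"
    using assms z_notin_E by auto
  moreover have "column_relation (A(\<gamma> := A b, z := 0)) X c \<longleftrightarrow> column_relation A X c"
    by (rule column_relation_cong) (use assms z_notin_E gamma_notin_E in auto)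
  ultimately show ?thesis
    by (simp add: column_relation_es_matrix_iff)
qed

lemma column_relation_es_matrix_insert_z:
  assumes "X \<subseteq> E" "a \<in> X" "b \<in> X"
  shows "column_relation B (insert z X) c \<longleftrightarrow> column_relation A X c \<and> c a + c b + c z = 0"
proof -
  have fin: "finite X" and z: "z \<notin> X"
    using assms finite_E z_notin_E finite_subset by blast+
  have "insert z X \<inter> {a, b, z} = {a, b, z}"
    using assms by auto
  moreover have "column_relation (A(\<gamma> := A b, z := 0)) (insert z X) c \<longleftrightarrow>
      column_relation (A(\<gamma> := A b, z := 0)) X c"
    using fin z by (simp add: column_relation_def)
  moreover have "\<dots> \<longleftrightarrow> column_relation A X c"
    by (rule column_relation_cong) (use assms z_notin_E gamma_notin_E in auto)
  ultimately show ?thesis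
    using fin by (simp add: column_relation_es_matrix_iff add.assoc)
qed

text \<open>None of \<open>a\<close>, \<open>b\<close>, \<open>z\<close> is present, so the balance
  condition is vacuous, and the coefficient of \<gamma> is handed over to \<open>b\<close>, whose
  column \<gamma> copies in the old rows.\<close>

lemma column_relation_es_matrix_insert_gamma:
  assumes "X \<subseteq> E - {a, b}"
  shows "column_relation B (insert \<gamma> X) c \<longleftrightarrow> column_relation A (insert b X) (c(b := c \<gamma>))"
proof -
  have fin: "finite X" and notin: "\<gamma> \<notin> X" "b \<notin> X" "z \<notin> X"
    using assms finite_E z_notin_E gamma_notin_E finite_subset by blast+
  have "insert \<gamma> X \<inter> {a, b, z} = {}"
    using assms notin by auto
  moreover have "(\<Sum>u\<in>X. c u *s (A(\<gamma> := A b, z := 0)) u) = (\<Sum>u\<in>X. (c(b := c \<gamma>)) u *s A u)"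
    by (rule sum.cong) (use notin in auto)
  ultimately show ?thesis
    using fin notin by (subst column_relation_es_matrix_iff) (simp_all add: column_relation_def)
qed

section \<open>Circuits of the es-splitting matroid \<open>N\<close> compared with circuits of
  \<open>M\<close>\<close>

lemma circuit_es_splitting_iff:
  "circuit N C \<longleftrightarrow> C \<subseteq> E \<union> {z, \<gamma>} \<and> (\<exists>c. column_relation B C c \<and> (\<exists>u\<in>C. c u \<noteq> 0)) \<and>
    (\<forall>c. column_relation B C c \<longrightarrow> (\<exists>u\<in>C. c u = 0) \<longrightarrow> (\<forall>u\<in>C. c u = 0))"
  unfolding es_splitting_def using finite_E by (subst circuit_vector_matroid_iff) auto

lemma circuit_es_splitting_subset: "circuit N C \<Longrightarrow> C \<subseteq> E \<union> {z, \<gamma>}"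
  by (simp add: circuit_es_splitting_iff)

text \<open>With a single element \<open>x\<close> present, the balance condition reads
  \<open>c x = 0\<close>, but a circuit has a relation without zeros.\<close>

lemma circuit_es_splitting_inter_not_singleton:
  assumes "circuit N D"
  shows "D \<inter> {a, b, z} \<noteq> {x}"
proof
  assume x: "D \<inter> {a, b, z} = {x}"
  obtain c where c: "column_relation B D c" "\<And>u. u \<in> D \<Longrightarrow> c u \<noteq> 0"
    using assms unfolding es_splitting_def
    by (rule circuit_vector_matroid_nonzero_relation[rotated]) (use finite_E in auto)
  have "finite D"
    using assms finite_E by (auto dest!: circuit_es_splitting_subset intro: finite_subset)
  then have "c x = 0"
    using c x by (simp add: column_relation_es_matrix_iff)
  then show False
    using c x by blast
qed

lemma circuit_es_splitting_avoiding_iff: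
  assumes "X \<subseteq> E - {a, b}"
  shows "circuit N X \<longleftrightarrow> circuit M X"
proof -
  have "X \<subseteq> E" "X \<subseteq> E \<union> {z, \<gamma>}"
    using assms by auto
  then show ?thesis
    by (simp add: circuit_es_splitting_iff circuit_vector_matroid_iff finite_E
      column_relation_es_matrix_avoiding[OF assms])
qed

text \<open>Each relation of \<open>X\<close> extends to \<open>z\<close> in exactly one way, by the
  value \<open>- c a - c b\<close>. For a relation without zeros on \<open>X\<close>, this value is
  nonzero exactly when the np-condition holds.\<close>

lemma circuit_es_splitting_insert_z_iff:
  assumes X: "X \<subseteq> E" "a \<in> X" "b \<in> X"
  shows "circuit N (insert z X) \<longleftrightarrow> np_circuit E A a b X"
proof
  note rel = column_relation_es_matrix_insert_z[OF X]
  have z: "z \<notin> X"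
    using X z_notin_E by blast
  have lift: "column_relation B (insert z X) (d(z := - d a - d b))"
    if "column_relation A X d" for d
  proof -
    have "column_relation A X (d(z := - d a - d b)) \<longleftrightarrow> column_relation A X d"
      by (rule column_relation_cong) (use z in auto)
    then show ?thesis
      using that by (simp add: rel)
  qed
  {
    assume L: "circuit N (insert z X)"
    obtain c where c: "column_relation B (insert z X) c" "\<And>u. u \<in> insert z X \<Longrightarrow> c u \<noteq> 0"
      using L unfolding es_splitting_def
      by (rule circuit_vector_matroid_nonzero_relation[rotated]) (use finite_E in auto)
    have cA: "column_relation A X c" "c a + c b + c z = 0"
      using c by (simp_all add: rel)
    \<comment> \<open>The sum is \<open>- c z\<close>, and \<open>z\<close> lies in the
      circuit.\<close>
    then have "circuit_coeffs A X c" "c a + c b \<noteq> 0"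
      using c by (auto simp: circuit_coeffs_def column_relation_def)
    moreover have "d u = 0"
      if d: "column_relation A X d" "v \<in> X" "d v = 0" "u \<in> X" for d u v
    proof -
      have "(d(z := - d a - d b)) v = 0"
        using d z by auto
      then have "(d(z := - d a - d b)) u = 0"
        using L lift[OF d(1)] d unfolding circuit_es_splitting_iff by blast
      moreover have "u \<noteq> z"
        using d z by blast
      ultimately show ?thesis
        by simp
    qed
    then have "circuit M X"
      unfolding circuit_vector_matroid_iff[OF finite_E] using X cA(1) c(2) by blast
    ultimately show "np_circuit E A a b X"
      using X by (auto simp: np_circuit_def)
  next
    assume R: "np_circuit E A a b X"
    \<comment> \<open>This intersection has two elements, which excludes the first alternative in
      the definition of an np-circuit.\<close>
    have "X \<inter> {a, b} = {a, b}"
      using X by auto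
    then obtain c where circ: "circuit M X"
      and c: "column_relation A X c" "\<And>u. u \<in> X \<Longrightarrow> c u \<noteq> 0" "c a + c b \<noteq> 0"
      using R by (auto simp: np_circuit_def circuit_coeffs_def column_relation_def)
    have sub: "insert z X \<subseteq> E \<union> {z, \<gamma>}"
      using X by auto
    have ex: "\<exists>d. column_relation B (insert z X) d \<and> (\<exists>u\<in>insert z X. d u \<noteq> 0)"
      using lift[OF c(1)] c(2)[OF X(2)] X(2)
      by (intro exI[of _ "c(z := - c a - c b)"] conjI bexI[of _ a]) auto
    have min: "d u = 0"
      if d: "column_relation B (insert z X) d" "v \<in> insert z X" "d v = 0" "u \<in> insert z X"
      for d u v
    proof -
      have dA: "column_relation A X d" "d a + d b + d z = 0"
        using d by (simp_all add: rel)
      have zero: "\<forall>u\<in>X. d u = 0"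
      proof (cases "v \<in> X")
        case True
        then show ?thesis
          using circ dA(1) d(3) unfolding circuit_vector_matroid_iff[OF finite_E] by blast
      next
        case False
        \<comment> \<open>Here the zero of \<open>d\<close> is at \<open>z\<close>, so the balance
          condition loses its last term.\<close>
        then have dab: "d a + d b = 0"
          using d dA by simp
        \<comment> \<open>The multiple of \<open>c\<close> that cancels \<open>d\<close> at \<open>a\<close> cancels it everywhere.\<close>
        define f where "f = (\<lambda>u. c a * d u - d a * c u)"
        have "(\<Sum>u\<in>X. f u *s A u) = c a *s (\<Sum>u\<in>X. d u *s A u) - d a *s (\<Sum>u\<in>X. c u *s A u)"
          by (simp add: f_def vec.scale_sum_right sum_subtractf vec.scale_left_diff_distrib)
        then have "column_relation A X f"
          using c dA by (simp add: column_relation_def)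
        moreover have "f a = 0"
          by (simp add: f_def)
        ultimately have f0: "\<forall>u\<in>X. f u = 0"
          using circ X unfolding circuit_vector_matroid_iff[OF finite_E] by blast
        \<comment> \<open>Substitute \<open>d b = - d a\<close>. As \<open>f b = 0\<close> and
          \<open>c a + c b\<close> is nonzero, \<open>d a\<close> vanishes; then \<open>f\<close> is
          \<open>c a\<close> times \<open>d\<close>, with \<open>c a\<close> nonzero.\<close>
        have "f b = - d a * (c a + c b)"
          using dab by (simp add: f_def add_eq_0_iff algebra_simps)
        then have "d a = 0"
          using f0 X c(3) by auto
        then show ?thesis
          using f0 c(2)[OF X(2)] by (simp add: f_def)
      qed
      then show "d u = 0"
        using d(4) dA(2) X by auto
    qed
    show "circuit N (insert z X)"
      unfolding circuit_es_splitting_iff using sub ex min by blast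
  }
qed

text \<open>Exchanging \<gamma> and \<open>b\<close> matches the relations on both sides without
  changing the set of values they take, and the criterion for circuits depends on relations only
  through that set.\<close>

lemma circuit_es_splitting_insert_gamma_iff:
  assumes X: "X \<subseteq> E - {a, b}"
  shows "circuit N (insert \<gamma> X) \<longleftrightarrow> circuit M (insert b X)"
proof -
  note rel = column_relation_es_matrix_insert_gamma[OF X]
  have notin: "\<gamma> \<notin> X" "b \<notin> X"
    using X gamma_notin_E by auto
  have sub: "insert \<gamma> X \<subseteq> E \<union> {z, \<gamma>}" "insert b X \<subseteq> E"
    using X b_in_E by auto
  have rel': "column_relation A (insert b X) d \<longleftrightarrow>
      column_relation B (insert \<gamma> X) (d(\<gamma> := d b))" for d
    unfolding rel by (rule column_relation_cong) (use notin in auto)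
  have vals: "(c(b := c \<gamma>)) ` insert b X = c ` insert \<gamma> X"
    "(c(\<gamma> := c b)) ` insert \<gamma> X = c ` insert b X" for c :: "'e \<Rightarrow> 'k"
    using notin by auto
  have transfer: "(\<exists>c. column_relation B (insert \<gamma> X) c \<and> P (c ` insert \<gamma> X)) \<longleftrightarrow>
      (\<exists>d. column_relation A (insert b X) d \<and> P (d ` insert b X))" (is "?L \<longleftrightarrow> ?R") for P
  proof
    assume ?L
    then obtain c where "column_relation B (insert \<gamma> X) c" "P (c ` insert \<gamma> X)"
      by blast
    then show ?R
      by (intro exI[of _ "c(b := c \<gamma>)"]) (simp only: rel vals simp_thms)
  next
    assume ?R
    then obtain d where "column_relation A (insert b X) d" "P (d ` insert b X)"
      by blast
    then show ?L
      by (intro exI[of _ "d(\<gamma> := d b)"]) (simp only: rel'[symmetric] vals simp_thms)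
  qed
  have "(\<exists>c. column_relation B (insert \<gamma> X) c \<and> (\<exists>u\<in>insert \<gamma> X. c u \<noteq> 0)) \<longleftrightarrow>
      (\<exists>c. column_relation A (insert b X) c \<and> (\<exists>u\<in>insert b X. c u \<noteq> 0))"
    using transfer[of "\<lambda>S. \<exists>x\<in>S. x \<noteq> 0"] unfolding bex_simps(7) .
  \<comment> \<open>Minimality quantifies universally over relations; its negation is existential
    and therefore has the shape that \<open>transfer\<close> accepts.\<close>
  moreover have "(\<exists>c. column_relation B (insert \<gamma> X) c \<and>
        ((\<exists>u\<in>insert \<gamma> X. c u = 0) \<and> \<not> (\<forall>u\<in>insert \<gamma> X. c u = 0))) \<longleftrightarrow>
      (\<exists>c. column_relation A (insert b X) c \<and>
        ((\<exists>u\<in>insert b X. c u = 0) \<and> \<not> (\<forall>u\<in>insert b X. c u = 0)))"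
    using transfer[of "\<lambda>S. (\<exists>x\<in>S. x = 0) \<and> \<not> (\<forall>x\<in>S. x = 0)"]
    unfolding bex_simps(7) ball_simps(9) .
  then have "(\<forall>c. column_relation B (insert \<gamma> X) c \<longrightarrow>
        (\<exists>u\<in>insert \<gamma> X. c u = 0) \<longrightarrow> (\<forall>u\<in>insert \<gamma> X. c u = 0)) \<longleftrightarrow>
      (\<forall>c. column_relation A (insert b X) c \<longrightarrow>
        (\<exists>u\<in>insert b X. c u = 0) \<longrightarrow> (\<forall>u\<in>insert b X. c u = 0))"
    by (simp only: not_ex[symmetric] not_imp[symmetric] de_Morgan_conj not_not imp_conv_disj
        not_all[symmetric] simp_thms)
  ultimately show ?thesis
    unfolding circuit_es_splitting_iff circuit_vector_matroid_iff[OF finite_E]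
    using sub by (simp only: simp_thms)
qed

section \<open>Partitions of the ground set of \<open>N\<close> into circuits, and the corresponding
  covers of \<open>E\<close>\<close>

lemma circuits_of_eulerian_es_splitting:
  assumes "eulerian N"
  obtains X Y \<R> where
    "X \<subseteq> E" "a \<in> X" "b \<in> X" "np_circuit E A a b X"
    "Y \<subseteq> E - {a, b}" "circuit M (insert b Y)" "X \<inter> Y = {}"
    "finite \<R>" "\<And>D. D \<in> \<R> \<Longrightarrow> circuit M D" "disjoint \<R>"
    "\<And>D. D \<in> \<R> \<Longrightarrow> D \<inter> (X \<union> Y) = {}" "E = X \<union> Y \<union> \<Union>\<R>"
proof -
  obtain \<C> where circ: "\<And>D. D \<in> \<C> \<Longrightarrow> circuit N D" and disj: "disjoint \<C>"
    and Un: "\<Union>\<C> = E \<union> {z, \<gamma>}"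
    using assms by (auto simp: eulerian_def es_splitting_def vector_matroid_def)
  have eq: "D = D'" if "D \<in> \<C>" "D' \<in> \<C>" "u \<in> D" "u \<in> D'" for D D' u
    using disj that by (auto simp: disjoint_def)
  have not1: "D \<inter> {a, b, z} \<noteq> {x}" if "D \<in> \<C>" for D x
    using circ circuit_es_splitting_inter_not_singleton that by blast
  obtain Da where Da: "Da \<in> \<C>" "a \<in> Da" using Un a_in_E by blast
  obtain Db where Db: "Db \<in> \<C>" "b \<in> Db" using Un b_in_E by blast
  obtain D where D: "D \<in> \<C>" "z \<in> D" using Un by blast
  obtain G where G: "G \<in> \<C>" "\<gamma> \<in> G" using Un by blast
  \<comment> \<open>If \<open>a\<close>, \<open>b\<close>, \<open>z\<close> were spread over several
    disjoint circuits, one of these would contain exactly one of the three.\<close>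
  have "Da = D \<and> Db = D"
    using not1[OF D(1), of z] not1[OF Da(1), of a] not1[OF Db(1), of b] Da Db D
      eq[OF Da(1) D(1)] eq[OF Db(1) D(1)] eq[OF Da(1) Db(1)] by blast
  then have ab: "a \<in> D" "b \<in> D"
    using Da Db by auto
  have DE: "D \<subseteq> E \<union> {z, \<gamma>}" and GE: "G \<subseteq> E \<union> {z, \<gamma>}"
    using D G Un by auto
  have gD: "\<gamma> \<notin> D"
  proof
    assume g: "\<gamma> \<in> D"
    \<comment> \<open>This is the defining relation of \<gamma> as column \<open>b\<close> minus
      column \<open>z\<close>. It vanishes at \<open>a\<close>, which also lies in \<open>D\<close>,
      against minimality.\<close>
    define c where "c = (\<lambda>u. if u = b then 1 else if u = z \<or> u = \<gamma> then -1 else 0 :: 'k)"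
    have "finite D"
      using DE finite_E by (auto intro: finite_subset)
    then have "column_relation B D c \<longleftrightarrow> column_relation B {b, z, \<gamma>} c"
      by (rule column_relation_mono_neutral) (use D ab g in \<open>auto simp: c_def\<close>)
    moreover have "column_relation B {b, z, \<gamma>} c"
      by (subst column_relation_es_matrix_iff)
        (auto simp: c_def column_relation_def Int_insert_left)
    moreover have "c a = 0" "c b \<noteq> 0"
      by (simp_all add: c_def)
    ultimately show False
      using circ[OF D(1)] ab unfolding circuit_es_splitting_iff by blast
  qed
  have GD: "G \<inter> D = {}"
    using eq[OF G(1) D(1)] gD G(2) by blast
  define X where "X = D - {z}"
  \<comment> \<open>\<open>b\<close> is left out of \<open>Y\<close> and restored only in
    \<open>insert b Y\<close>, so that \<open>X\<close>, \<open>Y\<close> and the remaining circuits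
    partition \<open>E\<close>.\<close>
  define Y where "Y = G - {\<gamma>}"
  define \<R> where "\<R> = \<C> - {D, G}"
  have DX: "D = insert z X" and GY: "G = insert \<gamma> Y"
    using D G by (auto simp: X_def Y_def)
  have X: "X \<subseteq> E" "a \<in> X" "b \<in> X"
    using DE gD ab by (auto simp: X_def)
  have Y: "Y \<subseteq> E - {a, b}"
    using GE GD D ab by (auto simp: Y_def)
  have R_disj: "D' \<inter> (D \<union> G) = {}" if "D' \<in> \<R>" for D'
    using that eq[of D' D] eq[of D' G] D G by (auto simp: \<R>_def)
  have R_sub: "D' \<subseteq> E - {a, b}" if "D' \<in> \<R>" for D'
  proof -
    have "D' \<subseteq> E \<union> {z, \<gamma>}"
      using that Un by (auto simp: \<R>_def)
    then show ?thesis
      using R_disj[OF that] D G ab by auto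
  qed
  show thesis
  proof
    show "np_circuit E A a b X"
      using circ[OF D(1)] circuit_es_splitting_insert_z_iff[OF X] DX by simp
    show "circuit M (insert b Y)"
      using circ[OF G(1)] circuit_es_splitting_insert_gamma_iff[OF Y] GY by simp
    show "X \<inter> Y = {}"
      using GD by (auto simp: X_def Y_def)
    show "finite \<R>"
      using R_sub finite_E by (intro finite_subset[of \<R> "Pow E"]) auto
    show "circuit M D'" if "D' \<in> \<R>" for D'
      using circ[of D'] that circuit_es_splitting_avoiding_iff[OF R_sub[OF that]]
      by (simp add: \<R>_def)
    show "disjoint \<R>"
      using disj by (auto simp: \<R>_def disjoint_def)
    show "D' \<inter> (X \<union> Y) = {}" if "D' \<in> \<R>" for D'
      using R_disj[OF that] by (auto simp: X_def Y_def)
    have "E \<union> {z, \<gamma>} = insert z X \<union> insert \<gamma> Y \<union> \<Union>\<R>"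
      unfolding DX[symmetric] GY[symmetric] Un[symmetric] using D G by (auto simp: \<R>_def)
    moreover have "X \<union> Y \<union> \<Union>\<R> \<subseteq> E"
      using X(1) Y R_sub by blast
    ultimately show "E = X \<union> Y \<union> \<Union>\<R>"
      using z_notin_E gamma_notin_E by (auto simp: set_eq_iff)
  qed (use X Y in auto)
qed

text \<open>The only overlap is \<open>b\<close>. Replacing it by \<gamma> in \<open>Y\<close> and
  adding \<open>z\<close> to \<open>X\<close> makes the circuits disjoint and covers both new
  elements.\<close>

lemma eulerian_es_splittingI:
  assumes X: "a \<in> X" "b \<in> X" "np_circuit E A a b X"
    and Y: "circuit M Y" "X \<inter> Y = {b}"
    and R: "\<And>D. D \<in> \<R> \<Longrightarrow> circuit M D" "disjoint \<R>"
      "\<And>D. D \<in> \<R> \<Longrightarrow> D \<inter> (X \<union> Y) = {}"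
    and E: "E = X \<union> Y \<union> \<Union>\<R>"
  shows "eulerian N"
proof -
  define Y' where "Y' = Y - {b}"
  have YY': "Y = insert b Y'"
    using Y by (auto simp: Y'_def)
  have XE: "X \<subseteq> E" and Y'E: "Y' \<subseteq> E - {a, b}"
    using E X Y by (auto simp: Y'_def)
  have RE: "D \<subseteq> E - {a, b}" if "D \<in> \<R>" for D
    using E R(3)[OF that] X that by auto
  define \<C> where "\<C> = insert (insert z X) (insert (insert \<gamma> Y') \<R>)"
  have "circuit N (insert z X)"
    using X XE by (simp add: circuit_es_splitting_insert_z_iff)
  moreover have "circuit N (insert \<gamma> Y')"
    using Y(1) YY' circuit_es_splitting_insert_gamma_iff[OF Y'E] by simp
  moreover have "circuit N D" if "D \<in> \<R>" for D
    using R(1)[OF that] circuit_es_splitting_avoiding_iff[OF RE[OF that]] by simp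
  ultimately have "\<forall>D\<in>\<C>. circuit N D"
    by (simp add: \<C>_def)
  moreover have "disjoint \<C>"
  proof -
    have 1: "insert z X \<inter> insert \<gamma> Y' = {}"
      using Y XE Y'E z_notin_E gamma_notin_E by (auto simp: Y'_def)
    have "insert z X \<inter> D = {} \<and> insert \<gamma> Y' \<inter> D = {}" if "D \<in> \<R>" for D
      using R(3)[OF that] RE[OF that] z_notin_E gamma_notin_E by (auto simp: Y'_def)
    then show ?thesis
      using R(2) 1 unfolding \<C>_def disjoint_def pairwise_insert by (auto simp: disjnt_def)
  qed
  moreover have "\<Union>\<C> = ground N"
    using E YY' X by (auto simp: \<C>_def es_splitting_def vector_matroid_def)
  ultimately show ?thesis
    unfolding eulerian_def by blast
qed

end

section \<open>Passage between a disjoint set of circuits and a sequence indexed from 1 to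
  \<open>k\<close>\<close>

theorem theorem4p1:
  fixes p :: nat
    and E :: "'e set"
    and A :: "'e \<Rightarrow> 'k::{field,finite} ^ 'm"
    and M :: "'e indep_system"
    and a b e z \<gamma> :: 'e
    and \<alpha> :: 'k
  assumes "prime p" and "p > 2" and "CARD('k) = p"
    and "finite E"
    and "M = vector_matroid E A"
    and "simple_matroid M" and "coloopless M"
    and "a \<in> E" and "b \<in> E" and "a \<noteq> b"
    and "\<alpha> \<noteq> 0"
    and "e = b"
    and "z \<notin> E" and "\<gamma> \<notin> E" and "z \<noteq> \<gamma>"
  shows "eulerian (es_splitting E A a b \<alpha> e z \<gamma>) \<longleftrightarrow>
    (\<exists>Cnp (k::nat) (C :: nat \<Rightarrow> 'e set).
        k \<ge> 1 \<and>
        np_circuit E A a b Cnp \<and> a \<in> Cnp \<and> b \<in> Cnp \<and>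
        (\<forall>i\<in>{1..k}. circuit M (C i)) \<and>
        E = Cnp \<union> (\<Union>i\<in>{1..k}. C i) \<and>
        Cnp \<inter> C 1 = {b} \<and>
        (\<forall>i\<in>{2..k}. Cnp \<inter> C i = {}) \<and>
        (\<forall>i\<in>{1..k}. \<forall>j\<in>{1..k}. i \<noteq> j \<longrightarrow> C i \<inter> C j = {}))"
    (is "_ \<longleftrightarrow> ?R")
proof -
  interpret es_splitting_setup E A a b z \<gamma> \<alpha>
    using assms by unfold_locales
  show ?thesis
  proof
    assume "eulerian (es_splitting E A a b \<alpha> e z \<gamma>)"
    then have "eulerian N"
      using \<open>e = b\<close> by simp
    then obtain X Y \<R> where
      X: "X \<subseteq> E" "a \<in> X" "b \<in> X" "np_circuit E A a b X" and
      Y: "Y \<subseteq> E - {a, b}" "circuit (vector_matroid E A) (insert b Y)" "X \<inter> Y = {}" and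
      R: "finite \<R>" "\<And>D. D \<in> \<R> \<Longrightarrow> circuit (vector_matroid E A) D" "disjoint \<R>"
        "\<And>D. D \<in> \<R> \<Longrightarrow> D \<inter> (X \<union> Y) = {}" and
      E: "E = X \<union> Y \<union> \<Union>\<R>"
      by (rule circuits_of_eulerian_es_splitting) blast
    obtain h where h: "bij_betw h {1..card \<R>} \<R>"
      using R(1) ex_bij_betw_nat_finite_1 by blast
    define k where "k = Suc (card \<R>)"
    \<comment> \<open>Index 1 is reserved for the circuit that meets \<open>X\<close> in
      \<open>b\<close>; the enumeration \<open>h\<close> of \<R> starts at 1 and is shifted to the
      indices from 2 to \<open>k\<close>.\<close>
    define C where "C = (\<lambda>i. if i = 1 then insert b Y else h (i - 1))"
    have C1: "C 1 = insert b Y"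
      by (simp add: C_def)
    have split: "{1..k} = insert 1 {2..k}"
      by (auto simp: k_def)
    have "{2..k} = Suc ` {1..card \<R>}"
      by (simp only: image_Suc_atLeastAtMost k_def numeral_2_eq_2 One_nat_def)
    moreover have "bij_betw (C \<circ> Suc) {1..card \<R>} \<R>"
      using h by (rule bij_betw_cong[THEN iffD1, rotated]) (simp add: C_def)
    ultimately have "bij_betw C {2..k} \<R>"
      by (metis bij_betw_def image_comp inj_on_imageI)
    then have Cimg: "C ` {2..k} = \<R>" and Cinj: "inj_on C {2..k}"
      by (simp_all add: bij_betw_def)
    have CR: "C i \<in> \<R>" if "i \<in> {2..k}" for i
      using Cimg that by blast
    have bi: "C 1 \<inter> C i = {}" "X \<inter> C i = {}" if "i \<in> {2..k}" for i
      using R(4)[OF CR[OF that]] X(3) unfolding C1 by auto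
    \<comment> \<open>Disjointness of \<R> concerns distinct sets, so injectivity of
      \<open>C\<close> is what makes it apply to distinct indices.\<close>
    have "C i \<inter> C j = {}" if "i \<in> {2..k}" "j \<in> {2..k}" "i \<noteq> j" for i j
      using R(3) CR that Cinj by (meson disjointD inj_onD)
    then have "\<forall>i\<in>{1..k}. \<forall>j\<in>{1..k}. i \<noteq> j \<longrightarrow> C i \<inter> C j = {}"
      unfolding split using bi(1) by blast
    moreover have "\<forall>i\<in>{1..k}. circuit M (C i)"
      unfolding split using CR R(2) Y(2) C1 assms(5) by auto
    moreover have "E = X \<union> (\<Union>i\<in>{1..k}. C i)"
      unfolding split using E Cimg X(3) C1 by auto
    moreover have "X \<inter> C 1 = {b}"
      using X Y C1 by auto
    moreover have "1 \<le> k"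
      by (simp add: k_def)
    ultimately show ?R
      using X bi(2) by blast
  next
    assume ?R
    then obtain X k C where k: "(1::nat) \<le> k"
      and X: "np_circuit E A a b X" "a \<in> X" "b \<in> X"
      and C: "\<forall>i\<in>{1..k}. circuit M (C i)" "E = X \<union> (\<Union>i\<in>{1..k}. C i)"
        "X \<inter> C 1 = {b}" "\<forall>i\<in>{2..k}. X \<inter> C i = {}"
        "\<forall>i\<in>{1..k}. \<forall>j\<in>{1..k}. i \<noteq> j \<longrightarrow> C i \<inter> C j = {}"
      by (elim exE conjE) (rule that)
    have split: "{1..k} = insert 1 {2..k}"
      using k by auto
    have "eulerian N"
    proof (rule eulerian_es_splittingI[OF X(2,3,1), of "C 1" "C ` {2..k}"])
      show "circuit (vector_matroid E A) (C 1)"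
        using C(1) k assms(5) by auto
      show "circuit (vector_matroid E A) D" if "D \<in> C ` {2..k}" for D
        using C(1) assms(5) that by auto
      show "disjoint (C ` {2..k})"
      proof (rule disjointI)
        fix D D' assume "D \<in> C ` {2..k}" "D' \<in> C ` {2..k}" "D \<noteq> D'"
        then obtain i j where "i \<in> {1..k}" "j \<in> {1..k}" "i \<noteq> j" "D = C i" "D' = C j"
          unfolding split by blast
        then show "D \<inter> D' = {}"
          using C(5) by simp
      qed
      show "D \<inter> (X \<union> C 1) = {}" if "D \<in> C ` {2..k}" for D
      proof -
        from that obtain i where i: "i \<in> {2..k}" "D = C i"
          by blast
        then have "i \<in> {1..k}" "1 \<in> {1..k}" "i \<noteq> 1"
          by auto
        then have "C i \<inter> C 1 = {}"
          using C(5) by blast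
        then show ?thesis
          using C(4) i by blast
      qed
      show "E = X \<union> C 1 \<union> \<Union> (C ` {2..k})"
        using C(2) unfolding split by (simp add: Un_assoc)
    qed (rule C(3))
    then show "eulerian (es_splitting E A a b \<alpha> e z \<gamma>)"
      using \<open>e = b\<close> by simp
  qed
qed

end
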